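(* Let $\mathcal{C}$ be a collection of strictly proper scoring rules of integral form (as defined in the context) that satisfies the uniform spread condition. Let $\{X_i\}_{i=1}^\infty$ be random variables on $\Omega$, let $\mathcal{D}$ be a collection of random variables on $\Omega$, and let $P$ be a prevision on $\mathcal{D}$ that is coherent$_3$ relative to $\mathcal{C}$. Suppose $X_i\in\mathcal{D}$ for all $i$ and put $p_i=P(X_i)\in\mathbb{R}$. For each $i$ let $g_i\in\mathcal{C}$ be the scoring rule used to score the forecast for $X_i$. Assume that the series $\sum_{i=1}^\infty|X_i(\omega)-p_i|$ and $\sum_{i=1}^\infty g_i(X_i(\omega),p_i)$ converge for every $\omega\in\Omega$, that the two resulting random variables belong to $\mathcal{D}$, and that $$P\Big[\sum_{i=1}^\infty |X_i-p_i|\Big]=V<\infty\quad\text{and}\quad P\Big[\sum_{i=1}^\infty g_i(X_i,p_i)\Big]=W<\infty .$$ Then there does not exist a sequence $\{q_i\}_{i=1}^\infty$ of real numbers (a rival set of forecasts) such that, for all $\omega\in\Omega$, $$\sum_{i=1}^\infty g_i(X_i(\omega),p_i)>\sum_{i=1}^\infty g_i(X_i(\omega),q_i).$$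
   Context: $\Omega$ is a nonempty set of states; a random variable is an arbitrary function $\Omega\to\mathbb{R}$ (no measurability is required). Scoring rules of integral form: $g:\mathbb{R}\times\mathbb{R}\to[0,\infty)$ ($x$ is the value of the random variable, $q$ the forecast, $g(x,q)$ the loss) is of integral form if there is a measure $\lambda$ on $\mathbb{R}$, mutually absolutely continuous with Lebesgue measure and finite on every bounded interval, such that $$g(x,q)=\int_x^q (v-x)\,d\lambda(v)\ \text{ if } x\le q,\qquad g(x,q)=\int_q^x (x-v)\,d\lambda(v)\ \text{ if } x>q .$$ (Such rules are strictly proper, i.e. expected score is uniquely minimized by taking the forecast equal to the mean.) For $a<b$ put $r(a,b,\lambda)=\dfrac{\int_a^b v\,d\lambda(v)}{\lambda((a,b))}$. Uniform spread condition: a collection $\mathcal{C}=\{g_i: i\in I\}$ of scoring rules of integral form with corresponding measures $\{\lambda_i: i\in I\}$ satisfies it if for every $\varepsilon>0$ there exists $\delta_\varepsilon>0$ such that for all $i\in I$ and all real $a<b$, $\lambda_i((a,b))>\varepsilon$ implies $a+\delta_\varepsilon\le r(a,b,\lambda_i)\le b-\delta_\varepsilon$. Coherence$_3$: a prevision (assignment of forecasts) $Y\mapsto P(Y)\in\mathbb{R}$, $Y\in\mathcal{D}$, is coherent$_3$ relative to $\mathcal{C}$ if for every finite set $Y_1,\dots,Y_n\in\mathcal{D}$, all scoring rules $h_1,\dots,h_n\in\mathcal{C}$, and all real alternative forecasts $q_1,\dots,q_n$, there is no $\varepsilon>0$ such that $$\sum_{j=1}^n h_j(Y_j(\omega),P(Y_j))\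 \ge\ \sum_{j=1}^n h_j(Y_j(\omega),q_j)+\varepsilon\quad\text{for all }\omega\in\Omega .$$ A sum of nonnegative terms that diverges is taken to equal $+\infty$. *)

theory Defs
  imports "HOL-Analysis.Analysis"
begin

text \<open>
  A loss \<open>g x q\<close> takes the realized value \<open>x\<close> and the forecast \<open>q\<close>.  The measure is mutually
  absolutely continuous with Lebesgue measure, so it has no atoms, and the choice of open
  intervals as domains of integration is immaterial.  Strict propriety is a consequence of
  integral form and is not a separate clause.
\<close>

definition integral_form :: "real measure \<Rightarrow> (real \<Rightarrow> real \<Rightarrow> real) \<Rightarrow> bool" where
  "integral_form lam g \<longleftrightarrow>
     sets lam = sets borel \<and>
     absolutely_continuous lborel lam \<and> absolutely_continuous lam lborel \<and>
     (\<forall>a b. emeasure lam {a..b} < \<infinity>) \<and>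
     (\<forall>x q. 0 \<le> g x q) \<and>
     (\<forall>x q. x \<le> q \<longrightarrow> g x q = (LINT v:{x<..<q}|lam. v - x)) \<and>
     (\<forall>x q. q < x \<longrightarrow> g x q = (LINT v:{q<..<x}|lam. x - v))"

definition interval_mean :: "real \<Rightarrow> real \<Rightarrow> real measure \<Rightarrow> real" where
  "interval_mean a b lam = (LINT v:{a<..<b}|lam. v) / measure lam {a<..<b}"

definition uniform_spread :: "'i set \<Rightarrow> ('i \<Rightarrow> real measure) \<Rightarrow> bool" where
  "uniform_spread I lam \<longleftrightarrow>
     (\<forall>\<epsilon>>0. \<exists>\<delta>>0. \<forall>i\<in>I. \<forall>a b. a < b \<longrightarrow> measure (lam i) {a<..<b} > \<epsilon> \<longrightarrow>
        a + \<delta> \<le> interval_mean a b (lam i) \<and> interval_mean a b (lam i) \<le> b - \<delta>)"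

text \<open>
  The state space is the (nonempty) type \<open>'w\<close>, and a random variable is any function on it.
  Only the values of \<open>P\<close> on \<open>D\<close> matter.  In \<open>coherent3\<close> the finite set \<open>S\<close> of random variables
  indexes the scoring rules \<open>h\<close> and the alternative forecasts \<open>q\<close>.
\<close>

definition coherent3 ::
  "(real \<Rightarrow> real \<Rightarrow> real) set \<Rightarrow> ('w \<Rightarrow> real) set \<Rightarrow> (('w \<Rightarrow> real) \<Rightarrow> real) \<Rightarrow> bool" where
  "coherent3 C D P \<longleftrightarrow>
     (\<forall>S h q. finite S \<longrightarrow> S \<subseteq> D \<longrightarrow> (\<forall>Y\<in>S. h Y \<in> C) \<longrightarrow>
        \<not> (\<exists>\<epsilon>>0. \<forall>\<omega>. (\<Sum>Y\<in>S. h Y (Y \<omega>) (P Y)) \<ge> (\<Sum>Y\<in>S. h Y (Y \<omega>) (q Y)) + \<epsilon>))"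

end

theory Submission
  imports Defs "HOL-Probability.Distribution_Functions"
begin

text \<open>
  The loss saved by replacing a forecast \<open>p\<close> by \<open>q\<close> is an affine function of the outcome \<open>x\<close>:
  it equals \<open>s * (x - r)\<close>, where \<open>s\<close> is the \<open>\<lambda>\<close>-mass between \<open>p\<close> and \<open>q\<close>, signed by the direction
  of the move, and \<open>r\<close> is the mean of \<open>\<lambda>\<close> between the two forecasts (lemma \<open>loss_saved_affine\<close>).
  A change of forecast is thus a bet on \<open>x\<close> at the price \<open>r\<close>, and compared with a bet at the price
  \<open>p\<close> it always carries the cost \<open>\<bar>s\<bar> * \<bar>r - p\<bar>\<close>.  For a small move this cost is negligible
  against the stake \<open>s\<close>, and every small stake is attained because \<open>\<lambda>\<close> has no atoms and full
  support.  Hence a prevision that is coherent for the scoring rules is coherent in the betting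
  sense: no finite system of bets \<open>c j * (Z j - P (Z j))\<close> has a total that is bounded below by a
  positive constant (lemma \<open>coherent3_no_sure_gain\<close>).

  Suppose now that rival forecasts \<open>q i\<close> dominate.  The saved losses \<open>s i * (X i \<omega> - r i)\<close> then
  form a convergent series with a positive sum.  Its terms tend to zero, and so do the distances
  \<open>\<bar>X i \<omega> - p i\<bar>\<close>; if infinitely many stakes were bounded away from zero, the uniform spread
  condition would keep \<open>r i\<close> away from \<open>p i\<close> and so from \<open>X i \<omega>\<close>, which is impossible.  So the
  stakes tend to zero, uniformly in \<open>\<omega>\<close> since they are constants
  (lemma \<open>stakes_tend_to_zero\<close>).
  Consequently the bets beyond a large index yield at most \<open>\<epsilon> * (\<Sum>i. \<bar>X i \<omega> - p i\<bar>)\<close>, a variable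
  whose prevision is \<open>\<epsilon> * V\<close>.  Some \<open>q k\<close> differs from \<open>p k\<close> and brings a positive cost (again by uniform spread), which
  does not depend on \<open>\<epsilon>\<close>.  For small \<open>\<epsilon>\<close> that cost exceeds \<open>\<epsilon> * V\<close>, and finitely many bets on
  the \<open>X i\<close>, together with one bet on \<open>\<Sum>i. \<bar>X i - p i\<bar>\<close>, have a gain bounded below by a positive
  constant, contrary to coherence.
\<close>

section \<open>The measure of a scoring rule of integral form\<close>

lemma integral_form_sets:
  "integral_form lam g \<Longrightarrow> A \<in> sets borel \<Longrightarrow> A \<in> sets lam"
  by (simp add: integral_form_def)

lemma integral_form_emeasure_bounded:
  assumes "integral_form lam g" "A \<subseteq> {a..b}"
  shows "emeasure lam A < \<infinity>"
proof -
  have "emeasure lam A \<le> emeasure lam {a..b}"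
    using assms by (intro emeasure_mono) (auto intro: integral_form_sets)
  also have "\<dots> < \<infinity>"
    using assms(1) unfolding integral_form_def by blast
  finally show ?thesis .
qed

lemma integral_form_no_atom:
  assumes "integral_form lam g"
  shows "{x} \<in> null_sets lam"
proof -
  have "null_sets lborel \<subseteq> null_sets lam"
    using assms unfolding integral_form_def absolutely_continuous_def by blast
  moreover have "{x} \<in> null_sets lborel"
    by (simp add: null_sets_def)
  ultimately show ?thesis by blast
qed

lemma integral_form_interval_pos:
  assumes "integral_form lam g" "a < b"
  shows "measure lam {a<..<b} > 0"
proof (rule ccontr)
  assume "\<not> ?thesis"
  then have "measure lam {a<..<b} = 0"
    using measure_nonneg[of lam "{a<..<b}"] by linarith
  moreover have "emeasure lam {a<..<b} \<noteq> \<infinity>"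
    using integral_form_emeasure_bounded[OF assms(1), of "{a<..<b}" a b] by force
  ultimately have "{a<..<b} \<in> null_sets lam"
    using integral_form_sets[OF assms(1)]
    by (auto simp: null_sets_def emeasure_eq_ennreal_measure)
  moreover have "null_sets lam \<subseteq> null_sets lborel"
    using assms(1) unfolding integral_form_def absolutely_continuous_def by blast
  ultimately have "emeasure lborel {a<..<b} = 0"
    by (auto simp: null_sets_def)
  then show False
    using \<open>a < b\<close> by simp
qed

lemma integral_form_set_integrable_affine:
  fixes c d :: real
  assumes "integral_form lam g"
  shows "set_integrable lam {a<..<b} (\<lambda>v. c + d * v)"
  unfolding set_integrable_def
proof (rule integrableI_bounded_set_indicator)
  show "{a<..<b} \<in> sets lam"
    using assms by (simp add: integral_form_sets)
  have "sets lam = sets borel"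
    using assms by (simp add: integral_form_def)
  then show "(\<lambda>v. c + d * v) \<in> borel_measurable lam"
    by (simp cong: measurable_cong_sets)
  show "emeasure lam {a<..<b} < \<infinity>"
    using integral_form_emeasure_bounded[OF assms, of "{a<..<b}" a b] by force
  have "\<bar>c + d * v\<bar> \<le> \<bar>c\<bar> + \<bar>d\<bar> * (\<bar>a\<bar> + \<bar>b\<bar>)" if "v \<in> {a<..<b}" for v
  proof -
    have "\<bar>c + d * v\<bar> \<le> \<bar>c\<bar> + \<bar>d\<bar> * \<bar>v\<bar>"
      by (metis abs_mult abs_triangle_ineq)
    also have "\<bar>d\<bar> * \<bar>v\<bar> \<le> \<bar>d\<bar> * (\<bar>a\<bar> + \<bar>b\<bar>)"
      using that by (intro mult_left_mono) auto
    finally show ?thesis by simp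
  qed
  then show "AE v in lam. v \<in> {a<..<b} \<longrightarrow> norm (c + d * v) \<le> \<bar>c\<bar> + \<bar>d\<bar> * (\<bar>a\<bar> + \<bar>b\<bar>)"
    by auto
qed

lemmas integral_form_set_integrable_const =
  integral_form_set_integrable_affine[where d = 0, simplified]
lemmas integral_form_set_integrable_id =
  integral_form_set_integrable_affine[where c = 0 and d = 1, simplified]
lemmas integral_form_set_integrable_diff =
  integral_form_set_integrable_affine[where d = "- 1", simplified]

lemma integral_form_integral_const:
  assumes "integral_form lam g"
  shows "(LINT v:{a<..<b}|lam. (c::real)) = measure lam {a<..<b} * c"
proof -
  have "emeasure lam {a<..<b} \<noteq> \<infinity>"
    using integral_form_emeasure_bounded[OF assms, of "{a<..<b}" a b] by force
  then show ?thesis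
    using set_integral_const[of "{a<..<b}" lam c] integral_form_sets[OF assms] by simp
qed

lemma integral_form_integral_diff:
  fixes x :: real
  assumes "integral_form lam g" "a < b"
  shows "(LINT v:{a<..<b}|lam. x - v) = measure lam {a<..<b} * (x - interval_mean a b lam)"
proof -
  have "(LINT v:{a<..<b}|lam. x - v) = (LINT v:{a<..<b}|lam. x) - (LINT v:{a<..<b}|lam. v)"
    by (intro set_integral_diff(2) integral_form_set_integrable_const[OF assms(1)]
        integral_form_set_integrable_id[OF assms(1)])
  moreover have "measure lam {a<..<b} * interval_mean a b lam = (LINT v:{a<..<b}|lam. v)"
    using integral_form_interval_pos[OF assms] by (simp add: interval_mean_def)
  ultimately show ?thesis
    by (simp add: integral_form_integral_const[OF assms(1)] right_diff_distrib)
qed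

lemma integral_form_interval_mean_bounds:
  assumes "integral_form lam g" "a < b"
  shows "a \<le> interval_mean a b lam" "interval_mean a b lam \<le> b"
proof -
  have "(LINT v:{a<..<b}|lam. a) \<le> (LINT v:{a<..<b}|lam. v)"
    by (intro set_integral_mono integral_form_set_integrable_const[OF assms(1)]
        integral_form_set_integrable_id[OF assms(1)]) auto
  then show "a \<le> interval_mean a b lam"
    using integral_form_interval_pos[OF assms]
    by (simp add: integral_form_integral_const[OF assms(1)] interval_mean_def field_simps)
  have "(LINT v:{a<..<b}|lam. v) \<le> (LINT v:{a<..<b}|lam. b)"
    by (intro set_integral_mono integral_form_set_integrable_const[OF assms(1)]
        integral_form_set_integrable_id[OF assms(1)]) auto
  then show "interval_mean a b lam \<le> b"
    using integral_form_interval_pos[OF assms]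
    by (simp add: integral_form_integral_const[OF assms(1)] interval_mean_def field_simps)
qed

lemma integral_form_integral_split:
  fixes x :: real
  assumes "integral_form lam g" "a \<le> b" "b \<le> c"
  shows "(LINT v:{a<..<c}|lam. x - v)
    = (LINT v:{a<..<b}|lam. x - v) + (LINT v:{b<..<c}|lam. x - v)"
proof -
  note int = integral_form_set_integrable_diff[OF assms(1)]
  have meas: "set_borel_measurable lam A (\<lambda>v. x - v)" if "A \<in> sets borel" for A
  proof -
    have "sets lam = sets borel"
      using assms(1) by (simp add: integral_form_def)
    then show ?thesis
      using that unfolding set_borel_measurable_def by (simp cong: measurable_cong_sets)
  qed
  have "AE v in lam. v \<noteq> b"
    using AE_not_in[OF integral_form_no_atom[OF assms(1), of b]] by simp
  then have "AE v in lam. v \<in> {a<..<b} \<union> {b<..<c} \<longleftrightarrow> v \<in> {a<..<c}"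
    by eventually_elim (use assms in auto)
  then have "(LINT v:{a<..<c}|lam. x - v) = (LINT v:{a<..<b} \<union> {b<..<c}|lam. x - v)"
    by (intro set_integral_cong_set meas) auto
  also have "\<dots> = (LINT v:{a<..<b}|lam. x - v) + (LINT v:{b<..<c}|lam. x - v)"
    by (intro set_integral_Un int) auto
  finally show ?thesis .
qed

section \<open>Changing a forecast is placing a bet\<close>

definition signed_mass :: "real measure \<Rightarrow> real \<Rightarrow> real \<Rightarrow> real" where
  "signed_mass lam p q = sgn (q - p) * measure lam {min p q<..<max p q}"

definition mean_between :: "real measure \<Rightarrow> real \<Rightarrow> real \<Rightarrow> real" where
  "mean_between lam p q = interval_mean (min p q) (max p q) lam"

lemma mean_between_commute: "mean_between lam p q = mean_between lam q p"
  by (simp add: mean_between_def min.commute max.commute)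

lemma signed_mass_swap: "signed_mass lam q p = - signed_mass lam p q"
proof -
  have "sgn (p - q) = - sgn (q - p)"
    by (metis minus_diff_eq sgn_minus)
  then show ?thesis
    by (simp add: signed_mass_def min.commute max.commute)
qed

lemma abs_signed_mass:
  "p \<noteq> q \<Longrightarrow> \<bar>signed_mass lam p q\<bar> = measure lam {min p q<..<max p q}"
  by (simp add: signed_mass_def abs_mult)

text \<open>
  Each loss integrates \<open>\<bar>v - x\<bar>\<close> between \<open>x\<close> and the forecast, so their difference is an integral
  between the forecasts.  Where \<open>v\<close> passes \<open>x\<close>, the kernel and the direction of integration
  change sign together; the difference is therefore the integral of \<open>x - v\<close> from \<open>p\<close> to \<open>q\<close>
  wherever \<open>x\<close> lies, and this is affine in \<open>x\<close>.
\<close>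

lemma loss_saved_affine:
  assumes "integral_form lam g"
  shows "g x p - g x q = signed_mass lam p q * (x - mean_between lam p q)"
proof -
  have below: "g x u = (LINT v:{x<..<u}|lam. v - x)" if "x \<le> u" for u
    using assms that unfolding integral_form_def by blast
  have neg: "(LINT v:{x<..<u}|lam. v - x) = - (LINT v:{x<..<u}|lam. x - v)" for u
    using set_integral_uminus[OF integral_form_set_integrable_diff[OF assms, of x u x]]
    by simp
  have above: "g x u = (LINT v:{u<..<x}|lam. x - v)" if "u < x" for u
    using assms that unfolding integral_form_def by blast
  have increasing: "g x u - g x w = signed_mass lam u w * (x - mean_between lam u w)"
    if "u < w" for u w
  proof -
    consider "x \<le> u" | "u < x" "x \<le> w" | "w < x" by linarith
    then have "g x u - g x w = (LINT v:{u<..<w}|lam. x - v)"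
    proof cases
      case 1
      then show ?thesis
        using that integral_form_integral_split[OF assms, of x u w x] below[of u] below[of w]
        by (simp add: neg)
    next
      case 2
      then show ?thesis
        using that integral_form_integral_split[OF assms, of u x w x] above[of u] below[of w]
        by (simp add: neg)
    next
      case 3
      then show ?thesis
        using that integral_form_integral_split[OF assms, of u w x x] above[of u] above[of w]
        by simp
    qed
    also have "\<dots> = signed_mass lam u w * (x - mean_between lam u w)"
      using that integral_form_integral_diff[OF assms that, of x]
      by (simp add: signed_mass_def mean_between_def)
    finally show ?thesis .
  qed
  consider "p < q" | "p = q" | "q < p" by linarith
  then show ?thesis
  proof cases
    case 1
    then show ?thesis by (rule increasing)
  next
    case 2
    then show ?thesis by (simp add: signed_mass_def)
  next
    case 3
    have "g x p - g x q = - (signed_mass lam q p * (x - mean_between lam q p))"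
      using increasing[OF 3] by simp
    then show ?thesis
      by (simp add: signed_mass_swap[of lam q p] mean_between_commute[of lam q p])
  qed
qed

text \<open>
  The cost of a change of forecast against a bet at the price \<open>p\<close>; the identity holds because the
  mean lies on the side of \<open>p\<close> to which the forecast moves.
\<close>

lemma signed_mass_mult_mean_diff:
  assumes "integral_form lam g"
  shows "signed_mass lam p q * (mean_between lam p q - p)
    = \<bar>signed_mass lam p q\<bar> * \<bar>mean_between lam p q - p\<bar>"
proof -
  consider "p < q" | "p = q" | "q < p" by linarith
  then show ?thesis
  proof cases
    case 1
    then show ?thesis
      using integral_form_interval_mean_bounds[OF assms 1]
      by (simp add: signed_mass_def mean_between_def)
  next
    case 2
    then show ?thesis by (simp add: signed_mass_def)
  next
    case 3
    then show ?thesis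
      using integral_form_interval_mean_bounds[OF assms 3]
      by (simp add: signed_mass_def mean_between_def abs_mult algebra_simps)
  qed
qed

lemma loss_saved_ge_bet:
  assumes "integral_form lam g"
  shows "g x p - g x q \<ge> signed_mass lam p q * (x - p) - \<bar>signed_mass lam p q\<bar> * \<bar>q - p\<bar>"
proof -
  have "\<bar>signed_mass lam p q\<bar> * \<bar>mean_between lam p q - p\<bar> \<le> \<bar>signed_mass lam p q\<bar> * \<bar>q - p\<bar>"
  proof (cases "p = q")
    case False
    then have "min p q < max p q" by auto
    then have "\<bar>mean_between lam p q - p\<bar> \<le> \<bar>q - p\<bar>"
      using integral_form_interval_mean_bounds[OF assms, of "min p q" "max p q"]
      unfolding mean_between_def by linarith
    then show ?thesis by (intro mult_left_mono) auto
  qed (simp add: signed_mass_def)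
  moreover have "g x p - g x q
    = signed_mass lam p q * (x - p) - signed_mass lam p q * (mean_between lam p q - p)"
    by (simp add: loss_saved_affine[OF assms] algebra_simps)
  ultimately show ?thesis
    using signed_mass_mult_mean_diff[OF assms, of p q] by linarith
qed

text \<open>
  The measure restricted to a neighbourhood of \<open>p\<close> is finite and without atoms, so its distribution
  function is continuous, and the signed masses are increments of it.  Full support makes
  these increments cover a neighbourhood of zero.
\<close>

lemma small_signed_masses_attained:
  assumes "integral_form lam g" "\<eta> > 0"
  shows "\<forall>\<^sub>F s in nhds 0. \<exists>q. \<bar>q - p\<bar> \<le> \<eta> \<and> signed_mass lam p q = s"
proof -
  define M where "M = density lam (indicator {p - \<eta>..p + \<eta>})"
  have M_eq: "emeasure M A = emeasure lam ({p - \<eta>..p + \<eta>} \<inter> A)" if "A \<in> sets borel" for A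
    unfolding M_def using that by (intro emeasure_restricted integral_form_sets[OF assms(1)]) auto
  have sets_M: "sets M = sets borel"
    using assms(1) by (simp add: M_def integral_form_def)
  then have space_M: "space M = UNIV"
    using sets_eq_imp_space_eq by force
  interpret finite_measure M
  proof (rule finite_measureI)
    have "emeasure M UNIV < \<infinity>"
      using integral_form_emeasure_bounded[OF assms(1) order_refl] by (simp add: M_eq)
    then show "emeasure M (space M) \<noteq> \<infinity>"
      by (simp add: space_M)
  qed
  interpret finite_borel_measure M
    by unfold_locales (rule sets_M)
  have cont: "continuous_on A (cdf M)" for A
  proof (intro continuous_at_imp_continuous_on ballI)
    fix x
    have "{p - \<eta>..p + \<eta>} \<inter> {x} \<in> null_sets lam"
      using integral_form_no_atom[OF assms(1), of x]
      by (cases "x \<in> {p - \<eta>..p + \<eta>}") auto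
    then have "measure M {x} = 0"
      by (simp add: measure_def M_eq null_setsD1)
    then show "isCont (cdf M) x"
      by (simp add: isCont_cdf)
  qed
  have increment: "cdf M w - cdf M u = measure lam {u<..<w}"
    if "u < w" "p - \<eta> \<le> u" "w \<le> p + \<eta>" for u w
  proof -
    have "cdf M w - cdf M u = measure M {u<..w}"
      by (rule cdf_diff_eq[OF that(1)])
    also have "\<dots> = measure lam {u<..w}"
    proof -
      have "{p - \<eta>..p + \<eta>} \<inter> {u<..w} = {u<..w}" using that by auto
      then show ?thesis by (simp add: measure_def M_eq)
    qed
    also have "\<dots> = measure lam {u<..<w}"
    proof -
      have "{u<..w} = {u<..<w} \<union> {w}" using that by auto
      then show ?thesis
        using measure_Un_null_set[OF _ integral_form_no_atom[OF assms(1), of w], of "{u<..<w}"]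
          integral_form_sets[OF assms(1)]
        by simp
    qed
    finally show ?thesis .
  qed
  have signed: "signed_mass lam p q = cdf M q - cdf M p" if "\<bar>q - p\<bar> \<le> \<eta>" for q
  proof -
    consider "p < q" | "p = q" | "q < p" by linarith
    then show ?thesis
    proof cases
      case 1
      then show ?thesis using increment[of p q] that assms(2) by (simp add: signed_mass_def)
    next
      case 2
      then show ?thesis by (simp add: signed_mass_def)
    next
      case 3
      then show ?thesis using increment[of q p] that assms(2) by (simp add: signed_mass_def)
    qed
  qed
  have pos: "cdf M (p + \<eta>) - cdf M p > 0" "cdf M p - cdf M (p - \<eta>) > 0"
    using increment[of p "p + \<eta>"] increment[of "p - \<eta>" p] assms(2)
      integral_form_interval_pos[OF assms(1), of p "p + \<eta>"]
      integral_form_interval_pos[OF assms(1), of "p - \<eta>" p]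
    by auto
  have "\<forall>\<^sub>F s in nhds 0. s \<in> {cdf M (p - \<eta>) - cdf M p <..< cdf M (p + \<eta>) - cdf M p}"
    using pos by (intro eventually_nhds_in_open) auto
  then show ?thesis
  proof eventually_elim
    case (elim s)
    then have "\<exists>q. p - \<eta> \<le> q \<and> q \<le> p + \<eta> \<and> cdf M q = cdf M p + s"
      using assms(2) by (intro IVT' cont) auto
    then obtain q where "p - \<eta> \<le> q" "q \<le> p + \<eta>" "cdf M q = cdf M p + s"
      by blast
    then show ?case
      by (intro exI[of _ q]) (auto simp: signed)
  qed
qed

section \<open>Coherence for scores implies coherence for bets\<close>

text \<open>
  Bets are realized as small changes of forecast with masses \<open>t * c Y\<close>.  Moves within
  \<open>\<eta>\<close> cost at most \<open>t * \<eta> * (\<Sum>Y\<in>S. \<bar>c Y\<bar>)\<close> in total, against a gain of \<open>t * \<epsilon>\<close>, and \<open>\<eta>\<close> can be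
  chosen before \<open>t\<close>.
\<close>

lemma coherent3_no_sure_gain_set:
  fixes D :: "('w \<Rightarrow> real) set"
  assumes coh: "coherent3 C D P" and "h \<in> C" and form: "integral_form lam h"
    and S: "finite S" "S \<subseteq> D" and "\<epsilon> > 0"
  shows "\<exists>\<omega>. (\<Sum>Y\<in>S. c Y * (Y \<omega> - P Y)) < \<epsilon>"
proof (rule ccontr)
  assume "\<not> ?thesis"
  then have gain: "(\<Sum>Y\<in>S. c Y * (Y \<omega> - P Y)) \<ge> \<epsilon>" for \<omega>
    by (simp add: not_less)
  define K where "K = (\<Sum>Y\<in>S. \<bar>c Y\<bar>)"
  have "K \<ge> 0" by (simp add: K_def sum_nonneg)
  define \<eta> where "\<eta> = \<epsilon> / (2 * (K + 1))"
  have "\<eta> > 0" using \<open>\<epsilon> > 0\<close> \<open>K \<ge> 0\<close> by (simp add: \<eta>_def)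
  have "\<forall>\<^sub>F t in at_right 0. \<exists>q. \<bar>q - P Y\<bar> \<le> \<eta> \<and> signed_mass lam (P Y) q = t * c Y" for Y
  proof -
    have "((\<lambda>t. t * c Y) \<longlongrightarrow> 0 * c Y) (at_right 0)"
      by (intro tendsto_intros)
    then have "filterlim (\<lambda>t. t * c Y) (nhds 0) (at_right 0)" by simp
    from filterlim_iff[THEN iffD1, OF this, rule_format,
        OF small_signed_masses_attained[OF form \<open>\<eta> > 0\<close>, of "P Y"]]
    show ?thesis .
  qed
  then have "\<forall>\<^sub>F t in at_right 0.
      \<forall>Y\<in>S. \<exists>q. \<bar>q - P Y\<bar> \<le> \<eta> \<and> signed_mass lam (P Y) q = t * c Y"
    using S(1) by (simp add: eventually_ball_finite)
  then have "\<forall>\<^sub>F t in at_right 0. t > 0 \<and>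
      (\<forall>Y\<in>S. \<exists>q. \<bar>q - P Y\<bar> \<le> \<eta> \<and> signed_mass lam (P Y) q = t * c Y)"
    using eventually_at_right_less[of "0::real"] by eventually_elim simp
  then obtain t where "t > 0" and
    ex: "\<forall>Y\<in>S. \<exists>q. \<bar>q - P Y\<bar> \<le> \<eta> \<and> signed_mass lam (P Y) q = t * c Y"
    using eventually_happens'[OF trivial_limit_at_right_real] by blast
  from bchoice[OF ex] obtain q where
    q: "\<And>Y. Y \<in> S \<Longrightarrow> \<bar>q Y - P Y\<bar> \<le> \<eta>" "\<And>Y. Y \<in> S \<Longrightarrow> signed_mass lam (P Y) (q Y) = t * c Y"
    by blast
  have "(\<Sum>Y\<in>S. h (Y \<omega>) (P Y)) \<ge> (\<Sum>Y\<in>S. h (Y \<omega>) (q Y)) + t * \<epsilon> / 2" for \<omega>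
  proof -
    have "t * c Y * (Y \<omega> - P Y) - t * \<bar>c Y\<bar> * \<eta> \<le> h (Y \<omega>) (P Y) - h (Y \<omega>) (q Y)"
      if "Y \<in> S" for Y
    proof -
      have "t * \<bar>c Y\<bar> * \<bar>q Y - P Y\<bar> \<le> t * \<bar>c Y\<bar> * \<eta>"
        using q(1)[OF that] \<open>t > 0\<close> by (intro mult_left_mono) auto
      moreover have "\<bar>signed_mass lam (P Y) (q Y)\<bar> = t * \<bar>c Y\<bar>"
        using \<open>t > 0\<close> by (simp add: q(2)[OF that] abs_mult)
      ultimately show ?thesis
        using loss_saved_ge_bet[OF form, of "P Y" "q Y" "Y \<omega>"] q(2)[OF that] by simp
    qed
    then have "(\<Sum>Y\<in>S. t * c Y * (Y \<omega> - P Y) - t * \<bar>c Y\<bar> * \<eta>)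
        \<le> (\<Sum>Y\<in>S. h (Y \<omega>) (P Y) - h (Y \<omega>) (q Y))"
      by (rule sum_mono)
    moreover have "(\<Sum>Y\<in>S. t * c Y * (Y \<omega> - P Y) - t * \<bar>c Y\<bar> * \<eta>)
        = t * (\<Sum>Y\<in>S. c Y * (Y \<omega> - P Y)) - t * (\<eta> * K)"
      by (simp add: sum_subtractf sum_distrib_left K_def mult_ac)
    moreover have "t * (\<Sum>Y\<in>S. c Y * (Y \<omega> - P Y)) \<ge> t * \<epsilon>"
      using gain \<open>t > 0\<close> by simp
    moreover have "t * (\<eta> * K) \<le> t * (\<epsilon> / 2)"
      using \<open>t > 0\<close> \<open>\<epsilon> > 0\<close> \<open>K \<ge> 0\<close> by (intro mult_left_mono) (auto simp: \<eta>_def field_simps)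
    ultimately show ?thesis
      by (simp add: sum_subtractf)
  qed
  moreover have "t * \<epsilon> / 2 > 0" using \<open>t > 0\<close> \<open>\<epsilon> > 0\<close> by simp
  ultimately have "\<exists>\<epsilon>>0. \<forall>\<omega>. (\<Sum>Y\<in>S. h (Y \<omega>) (P Y)) \<ge> (\<Sum>Y\<in>S. h (Y \<omega>) (q Y)) + \<epsilon>"
    by blast
  moreover have "\<not> (\<exists>\<epsilon>>0. \<forall>\<omega>. (\<Sum>Y\<in>S. h (Y \<omega>) (P Y)) \<ge> (\<Sum>Y\<in>S. h (Y \<omega>) (q Y)) + \<epsilon>)"
    using coh[unfolded coherent3_def, rule_format, of S "\<lambda>_. h" q] S \<open>h \<in> C\<close> by blast
  ultimately show False by blast
qed

text \<open>
  Coherence speaks of a set of random variables, whereas a family may repeat a variable.  Bets on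
  equal variables are merged by adding their stakes, which linearity permits.
\<close>

lemma coherent3_no_sure_gain:
  fixes Z :: "'j \<Rightarrow> 'w \<Rightarrow> real"
  assumes "coherent3 C D P" "h \<in> C" "integral_form lam h"
    and J: "finite J" and "Z ` J \<subseteq> D" "\<epsilon> > 0"
  shows "\<exists>\<omega>. (\<Sum>j\<in>J. c j * (Z j \<omega> - P (Z j))) < \<epsilon>"
proof -
  define d where "d Y = (\<Sum>j\<in>{j\<in>J. Z j = Y}. c j)" for Y
  have "(\<Sum>Y\<in>Z ` J. d Y * (Y \<omega> - P Y)) = (\<Sum>j\<in>J. c j * (Z j \<omega> - P (Z j)))" for \<omega>
    by (simp add: sum.image_gen[OF J, of _ Z] d_def sum_distrib_right)
  moreover have "\<exists>\<omega>. (\<Sum>Y\<in>Z ` J. d Y * (Y \<omega> - P Y)) < \<epsilon>"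
    using assms by (intro coherent3_no_sure_gain_set) auto
  ultimately show ?thesis by simp
qed

section \<open>Stakes of a convergent series of forecast changes\<close>

lemma uniform_spread_mean_away:
  assumes "uniform_spread I lam" "\<epsilon> > 0"
  obtains \<delta> where "\<delta> > 0"
    "\<And>i p q. i \<in> I \<Longrightarrow> \<bar>signed_mass (lam i) p q\<bar> > \<epsilon> \<Longrightarrow> \<bar>mean_between (lam i) p q - p\<bar> \<ge> \<delta>"
proof -
  obtain \<delta> where "\<delta> > 0" and \<delta>: "\<And>i a b. i \<in> I \<Longrightarrow> a < b \<Longrightarrow> measure (lam i) {a<..<b} > \<epsilon> \<Longrightarrow>
      a + \<delta> \<le> interval_mean a b (lam i) \<and> interval_mean a b (lam i) \<le> b - \<delta>"
    using assms(1)[unfolded uniform_spread_def, rule_format, OF assms(2)] by metis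
  have "\<bar>mean_between (lam i) p q - p\<bar> \<ge> \<delta>"
    if "i \<in> I" "\<bar>signed_mass (lam i) p q\<bar> > \<epsilon>" for i p q
  proof -
    have "p \<noteq> q" using that(2) \<open>\<epsilon> > 0\<close> by (auto simp: signed_mass_def)
    then have "min p q < max p q" by auto
    with \<delta>[OF that(1) this] that(2) abs_signed_mass[OF \<open>p \<noteq> q\<close>, of "lam i"]
    have "min p q + \<delta> \<le> mean_between (lam i) p q \<and> mean_between (lam i) p q \<le> max p q - \<delta>"
      by (simp add: mean_between_def)
    then show ?thesis by linarith
  qed
  with \<open>\<delta> > 0\<close> show ?thesis using that by blast
qed

text \<open>
  A stake of at least \<open>\<epsilon>\<close> exceeds \<open>\<epsilon> / 2\<close>, and uniform spread then puts the mean at least \<open>\<delta>\<close> away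
  from \<open>p n\<close>, with \<open>\<delta>\<close> depending on \<open>\<epsilon>\<close> only.  Once \<open>x n\<close> is within \<open>\<delta> / 2\<close> of \<open>p n\<close>, the saved loss
  is at least \<open>\<epsilon> / 2 * (\<delta> / 2)\<close> in absolute value, which happens only finitely often.
\<close>

lemma stakes_tend_to_zero:
  fixes p q x :: "nat \<Rightarrow> real"
  assumes spread: "uniform_spread I lam" and \<iota>: "\<And>n. \<iota> n \<in> I"
    and x: "(\<lambda>n. x n - p n) \<longlonglongrightarrow> 0"
    and saved: "(\<lambda>n. signed_mass (lam (\<iota> n)) (p n) (q n) *
      (x n - mean_between (lam (\<iota> n)) (p n) (q n))) \<longlonglongrightarrow> 0"
  shows "(\<lambda>n. signed_mass (lam (\<iota> n)) (p n) (q n)) \<longlonglongrightarrow> 0"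
proof -
  define a r where "a n = signed_mass (lam (\<iota> n)) (p n) (q n)"
    and "r n = mean_between (lam (\<iota> n)) (p n) (q n)" for n
  have "\<forall>\<^sub>F n in sequentially. \<bar>a n\<bar> < \<epsilon>" if "\<epsilon> > 0" for \<epsilon>
  proof -
    have "\<epsilon> / 2 > 0" using that by simp
    from uniform_spread_mean_away[OF spread this] obtain \<delta> where "\<delta> > 0" and
      \<delta>: "\<And>i p q. i \<in> I \<Longrightarrow> \<bar>signed_mass (lam i) p q\<bar> > \<epsilon> / 2 \<Longrightarrow> \<bar>mean_between (lam i) p q - p\<bar> \<ge> \<delta>"
      by blast
    have "\<forall>\<^sub>F n in sequentially. dist (x n - p n) 0 < \<delta> / 2"
      by (rule tendstoD[OF x]) (use \<open>\<delta> > 0\<close> in simp)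
    moreover have "\<forall>\<^sub>F n in sequentially. dist (a n * (x n - r n)) 0 < \<epsilon> / 2 * (\<delta> / 2)"
      unfolding a_def r_def by (rule tendstoD[OF saved]) (use \<open>\<delta> > 0\<close> \<open>\<epsilon> > 0\<close> in simp)
    ultimately show ?thesis
    proof eventually_elim
      case (elim n)
      show ?case
      proof (rule ccontr)
        assume "\<not> ?case"
        then have "\<bar>a n\<bar> > \<epsilon> / 2" using that by simp
        then have "\<bar>r n - p n\<bar> \<ge> \<delta>"
          unfolding a_def r_def by (rule \<delta>[OF \<iota>])
        moreover have "\<bar>x n - p n\<bar> < \<delta> / 2"
          using elim(1) by simp
        ultimately have "\<bar>x n - r n\<bar> \<ge> \<delta> / 2" by linarith
        then have "\<epsilon> / 2 * (\<delta> / 2) \<le> \<bar>a n\<bar> * \<bar>x n - r n\<bar>"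
          using \<open>\<bar>a n\<bar> > \<epsilon> / 2\<close> \<open>\<delta> > 0\<close> that by (intro mult_mono) auto
        then show False using elim(2) by (simp add: abs_mult)
      qed
    qed
  qed
  then show ?thesis
    by (simp add: tendsto_iff a_def)
qed

section \<open>Dominating countably many forecasts\<close>

theorem theorem1:
  fixes I :: "'i set"
    and rule :: "'i \<Rightarrow> real \<Rightarrow> real \<Rightarrow> real"
    and lam :: "'i \<Rightarrow> real measure"
    and C :: "(real \<Rightarrow> real \<Rightarrow> real) set"
    and D :: "('w \<Rightarrow> real) set"
    and P :: "('w \<Rightarrow> real) \<Rightarrow> real"
    and X :: "nat \<Rightarrow> 'w \<Rightarrow> real"
    and p :: "nat \<Rightarrow> real"
    and g :: "nat \<Rightarrow> real \<Rightarrow> real \<Rightarrow> real"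
    and V W :: real
  assumes "C = rule ` I"
    and "\<And>i. i \<in> I \<Longrightarrow> integral_form (lam i) (rule i)"
    and "uniform_spread I lam"
    and "coherent3 C D P"
    and "\<And>i. X i \<in> D"
    and "\<And>i. p i = P (X i)"
    and "\<And>i. g i \<in> C"
    and "\<And>\<omega>. summable (\<lambda>i. \<bar>X i \<omega> - p i\<bar>)"
    and "\<And>\<omega>. summable (\<lambda>i. g i (X i \<omega>) (p i))"
    and "(\<lambda>\<omega>. \<Sum>i. \<bar>X i \<omega> - p i\<bar>) \<in> D"
    and "(\<lambda>\<omega>. \<Sum>i. g i (X i \<omega>) (p i)) \<in> D"
    and "P (\<lambda>\<omega>. \<Sum>i. \<bar>X i \<omega> - p i\<bar>) = V"
    and "P (\<lambda>\<omega>. \<Sum>i. g i (X i \<omega>) (p i)) = W"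
  shows "\<not> (\<exists>q :: nat \<Rightarrow> real. \<forall>\<omega>.
           (\<Sum>i. ennreal (g i (X i \<omega>) (p i))) > (\<Sum>i. ennreal (g i (X i \<omega>) (q i))))"
proof
  assume "\<exists>q :: nat \<Rightarrow> real. \<forall>\<omega>.
           (\<Sum>i. ennreal (g i (X i \<omega>) (p i))) > (\<Sum>i. ennreal (g i (X i \<omega>) (q i)))"
  then obtain q where dom: "\<And>\<omega>. (\<Sum>i. ennreal (g i (X i \<omega>) (q i))) < (\<Sum>i. ennreal (g i (X i \<omega>) (p i)))"
    by blast
  have "\<forall>n. \<exists>i\<in>I. g n = rule i"
    using assms(1,7) by auto
  then obtain \<iota> where \<iota>: "\<And>n. \<iota> n \<in> I" and g_\<iota>: "\<And>n. g n = rule (\<iota> n)"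
    by metis
  have form: "integral_form (lam (\<iota> n)) (g n)" for n
    using assms(2)[OF \<iota>[of n]] by (simp add: g_\<iota>)
  have g_nonneg: "g n x u \<ge> 0" for n x u
    using form[of n] unfolding integral_form_def by blast
  define a r where "a n = signed_mass (lam (\<iota> n)) (p n) (q n)"
    and "r n = mean_between (lam (\<iota> n)) (p n) (q n)" for n
  define Y where "Y \<omega> = (\<Sum>i. \<bar>X i \<omega> - p i\<bar>)" for \<omega>
  have saved: "g n x (p n) - g n x (q n) = a n * (x - r n)" for n x
    by (simp add: loss_saved_affine[OF form[of n]] a_def r_def)
  have cost: "a n * (x - r n) = a n * (x - p n) - \<bar>a n\<bar> * \<bar>r n - p n\<bar>" for n x
    using signed_mass_mult_mean_diff[OF form[of n], of "p n" "q n"]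
    by (simp add: a_def r_def algebra_simps)

  have summable_q: "summable (\<lambda>n. g n (X n \<omega>) (q n))" for \<omega>
    using dom[of \<omega>] by (intro summable_suminf_not_top g_nonneg) auto
  have summable_saved: "summable (\<lambda>n. a n * (X n \<omega> - r n))" for \<omega>
    using summable_diff[OF assms(9) summable_q, of \<omega> \<omega>] by (simp add: saved)
  have total_pos: "(\<Sum>n. a n * (X n \<omega> - r n)) > 0" for \<omega>
  proof -
    have "(\<Sum>n. g n (X n \<omega>) (q n)) < (\<Sum>n. g n (X n \<omega>) (p n))"
      using dom[of \<omega>] by (simp add: suminf_ennreal2 g_nonneg summable_q assms(9)
          suminf_nonneg ennreal_less_iff)
    then show ?thesis
      using suminf_diff[OF assms(9) summable_q, of \<omega> \<omega>] by (simp add: saved)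
  qed

  have "(\<lambda>n. X n \<omega> - p n) \<longlonglongrightarrow> 0" for \<omega>
    using summable_LIMSEQ_zero[OF assms(8)] by (simp add: tendsto_rabs_zero_iff)
  then have a_lim: "a \<longlonglongrightarrow> 0"
    unfolding a_def[abs_def]
    by (rule stakes_tend_to_zero[OF assms(3) \<iota>])
      (use summable_LIMSEQ_zero[OF summable_saved] in \<open>simp add: a_def r_def\<close>)

  obtain k where "a k \<noteq> 0"
  proof -
    have False if "\<And>n. a n = 0"
      using total_pos that by simp
    then show ?thesis using that by blast
  qed
  define R where "R = \<bar>a k\<bar> * \<bar>r k - p k\<bar>"
  have "R > 0"
  proof -
    have "\<bar>a k\<bar> / 2 > 0" using \<open>a k \<noteq> 0\<close> by simp
    from uniform_spread_mean_away[OF assms(3) this] obtain \<delta> where "\<delta> > 0" and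
      \<delta>: "\<And>i p q. i \<in> I \<Longrightarrow> \<bar>signed_mass (lam i) p q\<bar> > \<bar>a k\<bar> / 2 \<Longrightarrow>
        \<bar>mean_between (lam i) p q - p\<bar> \<ge> \<delta>"
      by blast
    have "\<bar>r k - p k\<bar> \<ge> \<delta>"
      unfolding r_def using \<open>a k \<noteq> 0\<close> by (intro \<delta>[OF \<iota>]) (simp add: a_def)
    with \<open>\<delta> > 0\<close> \<open>a k \<noteq> 0\<close> show ?thesis by (auto simp: R_def)
  qed

  define \<epsilon> where "\<epsilon> = R / (2 * (\<bar>V\<bar> + 1))"
  have "\<epsilon> > 0" using \<open>R > 0\<close> by (simp add: \<epsilon>_def)
  have \<epsilon>V: "\<epsilon> * V \<le> R / 2"
  proof -
    have "\<epsilon> * V \<le> \<epsilon> * (\<bar>V\<bar> + 1)"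
      using \<open>\<epsilon> > 0\<close> by (intro mult_left_mono) auto
    also have "\<dots> = R / 2" by (simp add: \<epsilon>_def field_simps)
    finally show ?thesis .
  qed
  have "\<forall>\<^sub>F n in sequentially. dist (a n) 0 < \<epsilon>"
    by (rule tendstoD[OF a_lim \<open>\<epsilon> > 0\<close>])
  then obtain N0 where N0: "\<And>n. n \<ge> N0 \<Longrightarrow> \<bar>a n\<bar> < \<epsilon>"
    unfolding eventually_sequentially by auto
  \<comment> \<open>The head has to contain the index \<open>k\<close>, whose cost is to outweigh the tail.\<close>
  define N where "N = max N0 (Suc k)"
  have N: "k < N" "\<And>n. \<bar>a (n + N)\<bar> \<le> \<epsilon>"
    using N0 by (auto simp: N_def intro: less_imp_le)

  have head: "(\<Sum>n<N. a n * (X n \<omega> - r n)) \<le> (\<Sum>n<N. a n * (X n \<omega> - p n)) - R" for \<omega>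
  proof -
    have "R \<le> (\<Sum>n<N. \<bar>a n\<bar> * \<bar>r n - p n\<bar>)"
      unfolding R_def using N(1) by (intro member_le_sum) auto
    then show ?thesis by (simp add: cost sum_subtractf)
  qed
  have tail: "(\<Sum>n. a (n + N) * (X (n + N) \<omega> - r (n + N))) \<le> \<epsilon> * Y \<omega>" for \<omega>
  proof -
    have sumX: "summable (\<lambda>n. \<bar>X (n + N) \<omega> - p (n + N)\<bar>)"
      using summable_ignore_initial_segment[OF assms(8)] .
    have "a (n + N) * (X (n + N) \<omega> - r (n + N)) \<le> \<epsilon> * \<bar>X (n + N) \<omega> - p (n + N)\<bar>" for n
    proof -
      have "a (n + N) * (X (n + N) \<omega> - r (n + N)) \<le> a (n + N) * (X (n + N) \<omega> - p (n + N))"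
        by (simp add: cost)
      also have "\<dots> \<le> \<bar>a (n + N)\<bar> * \<bar>X (n + N) \<omega> - p (n + N)\<bar>"
        by (metis abs_ge_self abs_mult)
      also have "\<dots> \<le> \<epsilon> * \<bar>X (n + N) \<omega> - p (n + N)\<bar>"
        using N(2) by (intro mult_right_mono) auto
      finally show ?thesis .
    qed
    then have "(\<Sum>n. a (n + N) * (X (n + N) \<omega> - r (n + N))) \<le> (\<Sum>n. \<epsilon> * \<bar>X (n + N) \<omega> - p (n + N)\<bar>)"
      using summable_ignore_initial_segment[OF summable_saved]
      by (intro suminf_le summable_mult sumX) auto
    also have "\<dots> = \<epsilon> * (\<Sum>n. \<bar>X (n + N) \<omega> - p (n + N)\<bar>)"
      by (rule suminf_mult[OF sumX])
    also have "\<dots> \<le> \<epsilon> * Y \<omega>"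
    proof -
      have "(\<Sum>n. \<bar>X (n + N) \<omega> - p (n + N)\<bar>) \<le> Y \<omega>"
        unfolding Y_def by (subst suminf_split_initial_segment[OF assms(8), of \<omega> N])
          (simp add: sum_nonneg)
      then show ?thesis using \<open>\<epsilon> > 0\<close> by simp
    qed
    finally show ?thesis .
  qed
  have gain: "(\<Sum>n<N. a n * (X n \<omega> - p n)) + \<epsilon> * (Y \<omega> - V) \<ge> R / 2" for \<omega>
  proof -
    have "(\<Sum>n. a n * (X n \<omega> - r n))
        = (\<Sum>n. a (n + N) * (X (n + N) \<omega> - r (n + N))) + (\<Sum>n<N. a n * (X n \<omega> - r n))"
      by (rule suminf_split_initial_segment[OF summable_saved])
    with total_pos[of \<omega>] head[of \<omega>] tail[of \<omega>] \<epsilon>V show ?thesis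
      by (simp add: algebra_simps)
  qed

  \<comment> \<open>The index \<open>N\<close> is free in the finite family and carries the bet on \<open>Y\<close>.\<close>
  define Z where "Z n = (if n < N then X n else Y)" for n
  define c where "c n = (if n < N then a n else \<epsilon>)" for n
  have Y: "Y \<in> D" "P Y = V"
    using assms(10,12) by (simp_all add: Y_def[abs_def])
  have "(\<Sum>n\<in>{..N}. c n * (Z n \<omega> - P (Z n))) = (\<Sum>n<N. a n * (X n \<omega> - p n)) + \<epsilon> * (Y \<omega> - V)" for \<omega>
    by (simp add: lessThan_Suc_atMost[symmetric] c_def Z_def Y(2) assms(6))
  moreover have "\<exists>\<omega>. (\<Sum>n\<in>{..N}. c n * (Z n \<omega> - P (Z n))) < R / 2"
    using \<open>R > 0\<close> assms(5) Y(1)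
    by (intro coherent3_no_sure_gain[OF assms(4,7) form]) (auto simp: Z_def)
  ultimately show False
    using gain by (metis not_less)
qed

end
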